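(* Let $m,n\ge1$, let $\mathbb{X}$ be an $m$-dimensional real Banach space and let $\mathbb{Y}$ be an $n$-dimensional real Banach space. Suppose that $S_{\mathbb{X}^*}$ and $S_{\mathbb{Y}}$ admit ball coverings consisting of $p$ and $q$ balls, respectively. Then $S_{\mathbb{L}(\mathbb{X},\mathbb{Y})}$ admits a ball covering consisting of $k$ balls, where $k=\min\{mq,np\}$.
   Context: $\mathbb{L}(\mathbb{X},\mathbb{Y})$ is the space of (bounded) linear operators from $\mathbb{X}$ to $\mathbb{Y}$ with the operator norm; $S_{\mathbb{Z}}$ is the unit sphere of $\mathbb{Z}$. A subset $\mathcal{A}$ of a normed space $\mathbb{Z}$ admits a ball covering consisting of $k$ balls if there are $z_1,\dots,z_k\in\mathbb{Z}\setminus\{0\}$ and $0<r_i\le\|z_i\|$ with $\mathcal{A}\subseteq\bigcup_{i=1}^k B(z_i,r_i)$, where $B(z,r)$ is the open ball of center $z$ and radius $r$. *)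

theory Defs
  imports "HOL-Analysis.Analysis"
begin

definition admits_ball_covering :: "'z::real_normed_vector set \<Rightarrow> nat \<Rightarrow> bool" where
  "admits_ball_covering A k \<longleftrightarrow>
     (\<exists>(z :: nat \<Rightarrow> 'z) (r :: nat \<Rightarrow> real).
        (\<forall>i\<in>{1..k}. z i \<noteq> 0 \<and> 0 < r i \<and> r i \<le> norm (z i)) \<and>
        A \<subseteq> (\<Union>i\<in>{1..k}. ball (z i) (r i)))"

text \<open>
  The constant \<^const>\<open>dim\<close> is also \<open>0\<close> for infinite-dimensional spaces,
  so finite-dimensionality is stated separately.
\<close>

definition has_dimension :: "'a::real_vector itself \<Rightarrow> nat \<Rightarrow> bool" where
  "has_dimension _ d \<longleftrightarrow>
     (\<exists>B :: 'a set. finite B \<and> span B = UNIV) \<and> dim (UNIV :: 'a set) = d"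

end

theory Submission
  imports Defs
begin

text \<open>
  A unit vector lies in some ball with centre a positive multiple \<open>t *\<^sub>R z\<close> and radius
  \<open>norm (t *\<^sub>R z)\<close> as soon as moving from \<open>z\<close> against it decreases the norm to first order, that
  is, as soon as all functionals norming \<open>z\<close> are positive on it. For the rank-one operator with
  functional \<open>g\<close> and vector \<open>y\<close>, the relevant norming functionals on operators send \<open>T\<close> to
  \<open>\<psi> (T x)\<close>, where \<open>x\<close> is a unit vector normed by \<open>g\<close> and \<open>\<psi>\<close> norms \<open>y\<close>. If \<open>g\<close> norms a single
  vector \<open>e\<close>, the condition on \<open>T\<close> reduces to a condition on \<open>T e\<close>, namely that \<open>T e\<close> belongs to
  the cone that \<open>y\<close> defines in \<open>'y\<close>. If instead \<open>y\<close> is normed by a single functional \<open>\<phi>\<close>, it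
  reduces to a condition on the functional \<open>\<phi> o\<^sub>L T\<close>.

  For the bound \<open>m * q\<close>, take a basis of \<open>'x\<close> consisting of strongly exposed points \<open>e\<close> of the
  unit ball, with exposing functionals \<open>g\<close> (\<open>strongly_exposed_basis\<close>). A nonzero operator
  does not vanish at some \<open>e\<close>, so \<open>T e\<close> is caught by one of the \<open>q\<close> balls, and \<open>T\<close> by the
  corresponding rank-one centre. For the bound \<open>n * p\<close>, take at most \<open>n\<close> smooth points of the
  norm of \<open>'y\<close> whose derivatives \<open>\<phi>\<close> separate points (\<open>separating_smooth_supports\<close>); then
  some \<open>\<phi> o\<^sub>L T\<close> is nonzero and is caught by one of the \<open>p\<close> balls of the dual sphere. Both
  families exist because an extremal problem that involves an auxiliary Euclidean norm has a
  solution: points of the ball that maximise a quadratic function are strongly exposed, and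
  points at which a quadratic function touches the norm from above are smooth.

  Finitely many balls of fixed size are needed rather than cones, so all estimates are uniform
  in \<open>T\<close>: \<open>norm_rank_one_diff_exposing\<close> and \<open>norm_rank_one_diff_smooth\<close> bound the distance to
  the rank-one centres for all large \<open>t\<close> at once, and \<open>ball_covering_lifting\<close> combines
  them with a margin obtained from compactness of the two small spheres.
\<close>

section \<open>Coordinates and compactness in finite-dimensional normed spaces\<close>

definition finite_basis :: "'a::real_vector set \<Rightarrow> bool" where
  "finite_basis B \<longleftrightarrow> finite B \<and> independent B \<and> span B = UNIV"

lemma has_dimension_imp_finite_basis:
  assumes "has_dimension TYPE('a::real_vector) d"
  obtains B :: "'a::real_vector set" where "finite_basis B" "card B = d"
proof -
  obtain S :: "'a set" where S: "finite S" "span S = UNIV" and d: "dim (UNIV :: 'a set) = d"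
    using assms unfolding has_dimension_def by blast
  obtain B :: "'a set" where B: "independent B" "UNIV \<subseteq> span B" "card B = dim (UNIV :: 'a set)"
    using basis_exists[of "UNIV :: 'a set"] by metis
  have "finite B"
    using independent_span_bound[OF S(1) B(1)] S(2) by simp
  with B d that show thesis unfolding finite_basis_def by blast
qed

lemma sum_representation_finite_basis:
  assumes "finite_basis B"
  shows "(\<Sum>b\<in>B. representation B x b *\<^sub>R b) = x"
  using assms sum_representation_eq[of B x B] unfolding finite_basis_def by auto

lemma compact_PiE_UNIV:
  fixes S :: "'i \<Rightarrow> 'b::topological_space set"
  assumes "\<And>i. compact (S i)"
  shows "compact (PiE UNIV S)"
proof -
  have "compactin (product_topology (\<lambda>i. euclidean) UNIV) (PiE UNIV S)"
    unfolding compactin_PiE using assms by simp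
  then show ?thesis
    by (simp add: euclidean_product_topology)
qed

text \<open>
  Compactness in a finite-dimensional normed space comes from the space of coefficient families
  with the product topology: a box of coefficients is compact by Tychonoff's theorem, and
  forming the linear combination is continuous.
\<close>

lemma compact_linear_combinations:
  fixes B :: "'a::real_normed_vector set" and I :: "'a \<Rightarrow> real set"
  assumes "\<And>b. compact (I b)"
  shows "compact ((\<lambda>u. \<Sum>b\<in>B. u b *\<^sub>R b) ` PiE UNIV I)"
proof (rule compact_continuous_image)
  show "continuous_on (PiE UNIV I) (\<lambda>u. \<Sum>b\<in>B. u b *\<^sub>R b)"
    by (intro continuous_intros continuous_on_subset[OF continuous_on_product_coordinates]) auto
  show "compact (PiE UNIV I)"
    using assms by (rule compact_PiE_UNIV)
qed

text \<open>
  This is the equivalence of norms in finite dimension. The vectors whose coordinate at \<open>b\<close> is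
  \<open>1\<close> and whose other coordinates lie in \<open>[-1, 1]\<close> form a compact set that avoids \<open>0\<close> because
  the basis is independent, so their norms are bounded away from \<open>0\<close>. Every nonzero vector is
  a multiple of a vector in one of these finitely many sets.
\<close>

lemma representation_bound:
  fixes B :: "'a::real_normed_vector set"
  assumes B: "finite_basis B"
  obtains M where "0 < M" "\<And>x b. \<bar>representation B x b\<bar> \<le> M * norm x"
proof -
  let ?r = "representation B"
  have fin: "finite B" and ind: "independent B" and spn: "\<And>x. x \<in> span B"
    using B unfolding finite_basis_def by auto
  define I where "I b c = (if c = b then {1} else if c \<in> B then {-1..1} else {0::real})" for b c :: 'a
  define K where "K b = (\<lambda>u. \<Sum>c\<in>B. u c *\<^sub>R c) ` PiE UNIV (I b)" for b
  have cK: "compact (K b)" for b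
    unfolding K_def by (rule compact_linear_combinations) (simp add: I_def)
  have nK: "0 \<notin> K b" if "b \<in> B" for b
  proof
    assume "0 \<in> K b"
    then obtain u where u: "u \<in> PiE UNIV (I b)" "(\<Sum>c\<in>B. u c *\<^sub>R c) = 0"
      unfolding K_def by auto
    have "u b = 1" using u(1) unfolding I_def PiE_def Pi_def by (auto split: if_splits)
    moreover have "u b = 0"
      using independentD[OF ind fin subset_refl u(2) that] .
    ultimately show False by simp
  qed
  have "\<exists>d>0. \<forall>x\<in>K b. d \<le> dist 0 x" if "b \<in> B" for b
  proof -
    have "open (- K b)" "0 \<in> - K b"
      using compact_imp_closed[OF cK] nK[OF that] by auto
    then obtain e where e: "e > 0" "ball 0 e \<subseteq> - K b"
      unfolding open_contains_ball by blast
    show ?thesis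
      using e by (intro exI[of _ e]) (auto simp: subset_iff not_less[symmetric])
  qed
  then obtain d where d: "\<And>b. b \<in> B \<Longrightarrow> 0 < d b" "\<And>b x. b \<in> B \<Longrightarrow> x \<in> K b \<Longrightarrow> d b \<le> norm x"
    by (simp add: dist_norm) metis
  define M where "M = 1 + (\<Sum>b\<in>B. 1 / d b)"
  have Mge: "1 / d b \<le> M" if "b \<in> B" for b
  proof -
    have "1 / d b \<le> (\<Sum>b\<in>B. 1 / d b)"
      by (rule member_le_sum[OF that _ fin]) (use d(1) in \<open>force simp: less_imp_le\<close>)
    then show ?thesis by (simp add: M_def)
  qed
  have Mpos: "0 < M"
    using sum_nonneg[of B "\<lambda>b. 1 / d b"] d(1) unfolding M_def by (force simp: less_imp_le)
  show thesis
  proof (rule that[OF Mpos])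
    fix x b
    show "\<bar>?r x b\<bar> \<le> M * norm x"
    proof (cases "?r x b = 0")
      case True
      then show ?thesis
        using Mpos by simp
    next
      case False
      have bB: "b \<in> B" using False representation_ne_zero by blast
      \<comment> \<open>Dividing by a coordinate of largest modulus moves the vector into one of the compact sets.\<close>
      have "Max ((\<lambda>c. \<bar>?r x c\<bar>) ` B) \<in> (\<lambda>c. \<bar>?r x c\<bar>) ` B"
        using fin bB by (intro Max_in) auto
      then obtain m where m: "m \<in> B" "\<bar>?r x m\<bar> = Max ((\<lambda>c. \<bar>?r x c\<bar>) ` B)" by auto
      have mmax: "\<bar>?r x c\<bar> \<le> \<bar>?r x m\<bar>" if "c \<in> B" for c
        unfolding m(2) using fin that by (intro Max_ge) auto
      have a0: "?r x m \<noteq> 0" using mmax[OF bB] False by auto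
      define u where "u c = ?r x c / ?r x m" for c
      have "u c \<in> I m c" for c
      proof (cases "c \<in> B")
        case True
        have "\<bar>u c\<bar> \<le> 1"
          using a0 mmax[OF True] by (simp add: u_def abs_divide divide_le_eq)
        then have "u c \<in> {-1..1}" by (simp add: abs_le_iff)
        moreover have "u m = 1" using a0 by (simp add: u_def)
        ultimately show ?thesis using True by (auto simp: I_def)
      next
        case c: False
        then have "?r x c = 0" using representation_ne_zero by blast
        then show ?thesis using c m(1) by (auto simp: I_def u_def)
      qed
      then have "(\<Sum>c\<in>B. u c *\<^sub>R c) \<in> K m"
        unfolding K_def by (intro imageI) (simp add: PiE_def)
      moreover have "(\<Sum>c\<in>B. u c *\<^sub>R c) = (1 / ?r x m) *\<^sub>R x"
        unfolding u_def by (subst (3) sum_representation_finite_basis[OF B, of x, symmetric])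
          (simp add: scaleR_sum_right)
      ultimately have "d m \<le> norm ((1 / ?r x m) *\<^sub>R x)"
        using d(2)[OF m(1)] by metis
      then have "d m \<le> norm x / \<bar>?r x m\<bar>" by simp
      then have "\<bar>?r x m\<bar> \<le> (1 / d m) * norm x"
        using a0 d(1)[OF m(1)] by (simp add: field_simps)
      also have "\<dots> \<le> M * norm x"
        by (rule mult_right_mono[OF Mge[OF m(1)]]) simp
      finally show ?thesis using mmax[OF bB] by simp
    qed
  qed
qed

lemma bounded_linear_representation_finite_basis:
  fixes B :: "'a::real_normed_vector set"
  assumes B: "finite_basis B"
  shows "bounded_linear (\<lambda>x. representation B x b)"
proof -
  have ind: "independent B" and spn: "\<And>x. x \<in> span B"
    using B unfolding finite_basis_def by auto
  obtain M where "0 < M" "\<And>x b. \<bar>representation B x b\<bar> \<le> M * norm x"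
    using representation_bound[OF B] by metis
  then have "norm (representation B x b) \<le> norm x * M" for x
    by (simp add: mult.commute)
  then show ?thesis
    by (rule bounded_linear_intro[rotated 2])
      (simp_all only: representation_add[OF ind spn spn] representation_scale[OF ind spn] real_scaleR_def)
qed

lemma compact_cball_finite_basis:
  fixes B :: "'a::real_normed_vector set"
  assumes B: "finite_basis B"
  shows "compact (cball (a :: 'a) r)"
proof -
  obtain M where M: "0 < M" "\<And>x b. \<bar>representation B x b\<bar> \<le> M * norm x"
    using representation_bound[OF B] by metis
  define R where "R = M * (norm a + r)"
  let ?K = "(\<lambda>u. \<Sum>b\<in>B. u b *\<^sub>R b) ` PiE UNIV (\<lambda>b. {- R .. R})"
  have "compact ?K"
    by (rule compact_linear_combinations) simp
  moreover have "cball a r \<subseteq> ?K"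
  proof
    fix x assume "x \<in> cball a r"
    then have "norm x \<le> norm a + r"
      using norm_triangle_ineq2[of x a] by (simp add: dist_norm norm_minus_commute)
    then have "\<bar>representation B x b\<bar> \<le> R" for b
      using M(2)[of x b] M(1) unfolding R_def by (meson mult_left_mono order_trans less_imp_le)
    then have "representation B x \<in> PiE UNIV (\<lambda>b. {- R .. R})"
      by (simp add: PiE_def Pi_def abs_le_iff minus_le_iff)
    then have "(\<Sum>b\<in>B. representation B x b *\<^sub>R b) \<in> ?K" by blast
    then show "x \<in> ?K" by (simp add: sum_representation_finite_basis[OF B])
  qed
  ultimately show ?thesis
    using compact_Int_closed[of ?K "cball a r"] by (simp add: inf.absorb2)
qed

lemma compact_sphere_finite_basis:
  fixes B :: "'a::real_normed_vector set"
  assumes "finite_basis B"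
  shows "compact (sphere (a :: 'a) r)"
proof -
  have "compact (cball a r \<inter> sphere a r)"
    by (rule compact_Int_closed[OF compact_cball_finite_basis[OF assms]])
      (simp add: sphere_def closed_Collect_eq continuous_on_dist)
  then show ?thesis by (simp add: inf.absorb2 subset_iff)
qed

text \<open>
  The coordinate functionals span the dual space.
\<close>

lemma dual_finite_basis:
  fixes B :: "'a::real_normed_vector set"
  assumes B: "finite_basis B"
  obtains D :: "('a \<Rightarrow>\<^sub>L real) set" where "finite_basis D" "card D \<le> card B"
proof -
  have fin: "finite B" using B unfolding finite_basis_def by simp
  define c where "c b = Blinfun (\<lambda>x. representation B x b)" for b
  have c: "blinfun_apply (c b) x = representation B x b" for b x
    unfolding c_def by (simp add: bounded_linear_Blinfun_apply bounded_linear_representation_finite_basis[OF B])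
  have spn: "f \<in> span (c ` B)" for f :: "'a \<Rightarrow>\<^sub>L real"
  proof -
    have "f = (\<Sum>b\<in>B. f b *\<^sub>R c b)"
    proof (rule blinfun_eqI)
      fix x
      have "f x = f (\<Sum>b\<in>B. representation B x b *\<^sub>R b)"
        by (simp add: sum_representation_finite_basis[OF B])
      also have "\<dots> = (\<Sum>b\<in>B. f b *\<^sub>R c b) x"
        by (simp add: blinfun.sum_left blinfun.sum_right blinfun.scaleR_left blinfun.scaleR_right c mult.commute)
      finally show "f x = (\<Sum>b\<in>B. f b *\<^sub>R c b) x" .
    qed
    moreover have "(\<Sum>b\<in>B. f b *\<^sub>R c b) \<in> span (c ` B)"
      by (intro span_sum span_scale span_base imageI)
    ultimately show ?thesis by simp
  qed
  obtain D where D: "D \<subseteq> (UNIV :: ('a \<Rightarrow>\<^sub>L real) set)" "independent D" "UNIV \<subseteq> span D"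
    using maximal_independent_subset by blast
  have "finite D \<and> card D \<le> card (c ` B)"
    by (rule independent_span_bound) (use fin D spn in auto)
  moreover have "card (c ` B) \<le> card B" by (rule card_image_le[OF fin])
  ultimately show thesis
    using D by (intro that[of D]) (auto simp: finite_basis_def)
qed

text \<open>
  The form that makes the given basis orthonormal. It supplies an equivalent Euclidean norm
  without making the type an instance of a Euclidean space; the original norm is
  merely comparable with it.
\<close>

lemma finite_basis_inner_form:
  fixes B :: "'a::real_normed_vector set"
  assumes B: "finite_basis B"
  obtains ip :: "'a \<Rightarrow> 'a \<Rightarrow> real" and \<kappa> M where
    "bounded_bilinear ip" "\<And>x y. ip x y = ip y x" "0 < \<kappa>" "\<And>x. \<kappa> * (norm x)\<^sup>2 \<le> ip x x"
    "0 < M" "\<And>x. ip x x \<le> M * (norm x)\<^sup>2"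
proof -
  let ?r = "representation B"
  define ip where "ip x y = (\<Sum>b\<in>B. ?r x b * ?r y b)" for x y
  interpret r: bounded_linear "\<lambda>x. ?r x b" for b
    by (rule bounded_linear_representation_finite_basis[OF B])
  obtain M where M: "0 < M" "\<And>x b. \<bar>?r x b\<bar> \<le> M * norm x"
    using representation_bound[OF B] by metis
  define N where "N = real (card B) * M\<^sup>2 + 1"
  have Npos: "0 < N" unfolding N_def by (simp add: add_nonneg_pos)
  have bd: "\<bar>ip x y\<bar> \<le> N * (norm x * norm y)" for x y
  proof -
    have "\<bar>ip x y\<bar> \<le> (\<Sum>b\<in>B. \<bar>?r x b * ?r y b\<bar>)"
      unfolding ip_def by (rule sum_abs)
    also have "\<dots> \<le> (\<Sum>b\<in>B. (M * norm x) * (M * norm y))"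
      unfolding abs_mult using M by (intro sum_mono mult_mono) auto
    also have "\<dots> = real (card B) * M\<^sup>2 * (norm x * norm y)"
      by (simp add: power2_eq_square mult_ac)
    also have "\<dots> \<le> N * (norm x * norm y)"
      unfolding N_def by (simp add: algebra_simps)
    finally show ?thesis .
  qed
  have bil: "bounded_bilinear ip"
  proof
    show "\<exists>K. \<forall>a b. norm (ip a b) \<le> norm a * norm b * K"
      using bd by (intro exI[of _ N]) (simp add: mult_ac)
  qed (simp_all add: ip_def r.add r.scaleR ring_distribs sum.distrib sum_distrib_left mult_ac)
  define S where "S = (\<Sum>b\<in>B. (norm b)\<^sup>2) + 1"
  have Spos: "0 < S" unfolding S_def by (simp add: add_nonneg_pos sum_nonneg)
  have low: "(1 / S) * (norm x)\<^sup>2 \<le> ip x x" for x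
  proof -
    have "norm x = norm (\<Sum>b\<in>B. ?r x b *\<^sub>R b)"
      by (simp add: sum_representation_finite_basis[OF B])
    also have "\<dots> \<le> (\<Sum>b\<in>B. \<bar>?r x b\<bar> * norm b)"
      by (rule order_trans[OF norm_sum]) simp
    finally have "(norm x)\<^sup>2 \<le> (\<Sum>b\<in>B. \<bar>?r x b\<bar> * norm b)\<^sup>2"
      by (simp add: power_mono)
    also have "\<dots> \<le> (\<Sum>b\<in>B. \<bar>?r x b\<bar>\<^sup>2) * (\<Sum>b\<in>B. (norm b)\<^sup>2)"
      by (rule Cauchy_Schwarz_ineq_sum)
    also have "\<dots> = ip x x * (\<Sum>b\<in>B. (norm b)\<^sup>2)"
      by (simp add: ip_def power2_eq_square)
    also have "\<dots> \<le> ip x x * S"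
      unfolding S_def ip_def by (intro mult_left_mono sum_nonneg) auto
    finally show ?thesis using Spos by (simp add: field_simps)
  qed
  show thesis
    by (rule that[OF bil _ _ low Npos])
      (use bd[of x x for x] Spos in \<open>simp_all add: ip_def mult.commute power2_eq_square abs_le_iff\<close>)
qed

section \<open>Strongly exposed points\<close>

lemma norm_blinfun_le_unit:
  fixes f :: "'a::real_normed_vector \<Rightarrow>\<^sub>L 'b::real_normed_vector"
  assumes "0 \<le> b" and "\<And>x. norm x = 1 \<Longrightarrow> norm (f x) \<le> b"
  shows "norm f \<le> b"
proof (rule norm_blinfun_bound[OF assms(1)])
  fix x
  show "norm (f x) \<le> b * norm x"
  proof (cases "x = 0")
    case False
    then have "norm (f ((1 / norm x) *\<^sub>R x)) \<le> b" by (intro assms(2)) simp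
    with False show ?thesis by (simp add: blinfun.scaleR_right field_simps)
  qed simp
qed

text \<open>
  The slices of the unit ball cut off by \<open>g\<close> near its maximum shrink to \<open>e\<close>. By Smulian's
  criterion this says that the dual norm is Frechet differentiable at \<open>g\<close> with derivative
  evaluation at \<open>e\<close>; it is the dual counterpart of \<open>smooth_support\<close> below.
\<close>

definition strongly_exposes :: "('a::real_normed_vector \<Rightarrow>\<^sub>L real) \<Rightarrow> 'a \<Rightarrow> bool" where
  "strongly_exposes g e \<longleftrightarrow> norm g = 1 \<and> norm e \<le> 1 \<and>
     (\<forall>\<epsilon>>0. \<exists>\<eta>>0. \<forall>x. norm x \<le> 1 \<longrightarrow> 1 - \<eta> \<le> g x \<longrightarrow> norm (x - e) \<le> \<epsilon>)"

text \<open>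
  Let \<open>e\<close> maximise \<open>q + t * f\<close> on the unit ball, where \<open>q\<close> is the square of a Euclidean norm.
  Up to a constant this is a squared Euclidean distance to a far away centre, and a point of a
  convex body farthest from a given centre is exposed, with a quadratic gap, by the derivative
  of the function there. If \<open>f e\<close> were \<open>0\<close>, the maximum would be at most the maximum of \<open>q\<close>;
  a large \<open>t\<close> excludes this.
\<close>

lemma exists_strongly_exposed:
  fixes f :: "'a::real_normed_vector \<Rightarrow>\<^sub>L real" and B :: "'a set"
  assumes B: "finite_basis B" and f: "f \<noteq> 0"
  shows "\<exists>g e. strongly_exposes g e \<and> f e \<noteq> 0"
proof -
  obtain ip :: "'a \<Rightarrow> 'a \<Rightarrow> real" and \<kappa> M where ip: "bounded_bilinear ip"
    and sym: "\<And>x y. ip x y = ip y x" and \<kappa>: "0 < \<kappa>" "\<And>x. \<kappa> * (norm x)\<^sup>2 \<le> ip x x"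
    and M: "0 < M" "\<And>x. ip x x \<le> M * (norm x)\<^sup>2"
    using finite_basis_inner_form[OF B] by metis
  interpret ip: bounded_bilinear ip by (rule ip)
  have pos: "0 \<le> ip x x" for x
    using \<kappa>(1) by (intro order_trans[OF _ \<kappa>(2)]) simp
  obtain x1 where x1: "f x1 \<noteq> 0"
    using f by (metis blinfun_eqI zero_blinfun.rep_eq)
  define x0 where "x0 = (sgn (f x1) / norm x1) *\<^sub>R x1"
  have x1n: "x1 \<noteq> 0" using x1 by auto
  have x0: "norm x0 \<le> 1" "0 < f x0"
    using x1 x1n by (simp_all add: x0_def blinfun.scaleR_right abs_sgn_eq sgn_mult_self_eq zero_less_mult_iff sgn_if zero_less_divide_iff)
  \<comment> \<open>With this \<open>t\<close> the value at \<open>x0\<close> exceeds \<open>M\<close>, an upper bound for the quadratic term on the ball.\<close>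
  define t where "t = (M + 1) / f x0"
  define F where "F x = ip x x + t * f x" for x
  have "\<exists>e\<in>cball 0 1. \<forall>y\<in>cball 0 1. F y \<le> F e"
    unfolding F_def
    by (rule continuous_attains_sup)
      (auto intro!: compact_cball_finite_basis[OF B] continuous_intros ip.continuous_on)
  then obtain e where e: "norm e \<le> 1" and max: "\<And>y. norm y \<le> 1 \<Longrightarrow> F y \<le> F e"
    by auto
  have fe: "f e \<noteq> 0"
  proof
    assume "f e = 0"
    then have "F e \<le> M * (norm e)\<^sup>2" using M(2) by (simp add: F_def)
    also have "\<dots> \<le> M" using e M(1) by (simp add: power_le_one)
    also have "\<dots> < F x0"
      using x0 pos[of x0] by (simp add: F_def t_def)
    finally show False using max[OF x0(1)] by simp
  qed
  \<comment> \<open>The derivative at \<open>e\<close> of the function maximised.\<close>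
  define g0 where "g0 = Blinfun (\<lambda>x. 2 * ip e x + t * f x)"
  have g0: "g0 x = 2 * ip e x + t * f x" for x
    unfolding g0_def
    by (subst bounded_linear_Blinfun_apply)
      (auto intro!: bounded_linear_intros bounded_linear_const_mult ip.bounded_linear_right blinfun.bounded_linear_right)
  have gap: "\<kappa> * (norm (e - y))\<^sup>2 \<le> g0 e - g0 y" if "norm y \<le> 1" for y
  proof -
    have "\<kappa> * (norm (e - y))\<^sup>2 \<le> ip (e - y) (e - y)" by (rule \<kappa>(2))
    also have "\<dots> \<le> g0 e - g0 y"
      using max[OF that] by (simp add: F_def g0 ip.diff_left ip.diff_right sym[of y e])
    finally show ?thesis .
  qed
  have le: "g0 y \<le> g0 e" if "norm y \<le> 1" for y
  proof -
    have "0 \<le> \<kappa> * (norm (e - y))\<^sup>2" using \<kappa>(1) by simp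
    with gap[OF that] show ?thesis by linarith
  qed
  have N: "0 < g0 e"
  proof -
    have "e \<noteq> 0" using fe by auto
    then have "0 < \<kappa> * (norm e)\<^sup>2" using \<kappa>(1) by simp
    with gap[of 0] show ?thesis by simp
  qed
  have "norm g0 \<le> g0 e"
  proof (rule norm_blinfun_le_unit)
    fix x :: 'a assume "norm x = 1"
    then show "norm (g0 x) \<le> g0 e"
      using le[of x] le[of "- x"] by (simp add: blinfun.minus_right abs_le_iff)
  qed (use N in simp)
  moreover have "g0 e \<le> norm g0"
  proof -
    have "g0 e \<le> norm g0 * norm e" using norm_blinfun[of g0 e] by simp
    also have "\<dots> \<le> norm g0" using e by (simp add: mult_left_le)
    finally show ?thesis .
  qed
  ultimately have ng: "norm g0 = g0 e" by simp
  define g where "g = (1 / g0 e) *\<^sub>R g0"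
  have "strongly_exposes g e"
    unfolding strongly_exposes_def
  proof (intro conjI allI impI)
    show "norm g = 1" using N by (simp add: g_def ng)
    show "norm e \<le> 1" by (rule e)
    fix \<epsilon> :: real assume \<epsilon>: "0 < \<epsilon>"
    show "\<exists>\<eta>>0. \<forall>x. norm x \<le> 1 \<longrightarrow> 1 - \<eta> \<le> g x \<longrightarrow> norm (x - e) \<le> \<epsilon>"
    proof (intro exI[of _ "\<kappa> * \<epsilon>\<^sup>2 / g0 e"] conjI allI impI)
      show "0 < \<kappa> * \<epsilon>\<^sup>2 / g0 e" using \<epsilon> \<kappa>(1) N by simp
      fix x assume x: "norm x \<le> 1" "1 - \<kappa> * \<epsilon>\<^sup>2 / g0 e \<le> g x"
      have "g0 e * (1 - \<kappa> * \<epsilon>\<^sup>2 / g0 e) \<le> g0 e * g x"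
        using x(2) N by simp
      then have "g0 e - g0 x \<le> \<kappa> * \<epsilon>\<^sup>2"
        using N by (simp add: g_def blinfun.scaleR_left right_diff_distrib)
      with gap[OF x(1)] have "\<kappa> * (norm (e - x))\<^sup>2 \<le> \<kappa> * \<epsilon>\<^sup>2" by simp
      then have "(norm (e - x))\<^sup>2 \<le> \<epsilon>\<^sup>2" using \<kappa>(1) by simp
      then show "norm (x - e) \<le> \<epsilon>"
        using power2_le_imp_le[of "norm (e - x)" \<epsilon>] \<epsilon> by (simp add: norm_minus_commute[of x e])
    qed
  qed
  with fe show ?thesis by blast
qed

text \<open>
  If the strongly exposed points spanned a proper subspace, a nonzero functional would vanish on
  all of them, contrary to \<open>exists_strongly_exposed\<close>. The functional is a coordinate
  with respect to a basis that extends a basis of that subspace.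
\<close>

lemma strongly_exposed_basis:
  fixes B :: "'a::real_normed_vector set"
  assumes B: "finite_basis B"
  shows "\<exists>E :: 'a set. finite_basis E \<and> card E \<le> card B \<and> (\<forall>e\<in>E. \<exists>g. strongly_exposes g e)"
proof -
  let ?S = "{e :: 'a. \<exists>g. strongly_exposes g e}"
  have bound: "finite D \<and> card D \<le> card B" if "independent D" for D :: "'a set"
    by (rule independent_span_bound) (use B that in \<open>auto simp: finite_basis_def\<close>)
  obtain E where E: "E \<subseteq> ?S" "independent E" "?S \<subseteq> span E"
    using maximal_independent_subset by blast
  have "span E = UNIV"
  proof (rule ccontr)
    assume "span E \<noteq> UNIV"
    then obtain u where u: "u \<notin> span E" by blast
    then have "independent (insert u E)" using E(2) by (rule independent_insertI)
    then obtain D where D: "insert u E \<subseteq> D" "independent D" "UNIV \<subseteq> span D"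
      by (metis maximal_independent_subset_extend subset_UNIV)
    have fD: "finite_basis D" using D bound by (auto simp: finite_basis_def)
    define f where "f = Blinfun (\<lambda>x. representation D x u)"
    have f: "f x = representation D x u" for x
      unfolding f_def
      by (simp add: bounded_linear_Blinfun_apply bounded_linear_representation_finite_basis[OF fD])
    have "f u = 1" using D(1) by (simp add: f representation_basis[OF D(2)])
    then have "f \<noteq> 0" by auto
    then obtain g e where ge: "strongly_exposes g e" "f e \<noteq> 0"
      using exists_strongly_exposed[OF fD] by blast
    have "f x = 0" if "x \<in> span E" for x
      using that
    proof (induction rule: span_induct_alt)
      case (step a x y)
      have "x \<in> D" "u \<noteq> x" using step u D(1) span_base by auto
      then have "f x = 0" by (simp add: f representation_basis[OF D(2)])
      with step show ?case by (simp add: blinfun.add_right blinfun.scaleR_right)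
    qed simp
    moreover have "e \<in> span E" using E(3) ge(1) by blast
    ultimately show False using ge(2) by blast
  qed
  then show ?thesis using E bound by (intro exI[of _ E]) (auto simp: finite_basis_def)
qed

section \<open>Smooth points\<close>

text \<open>
  This says that \<open>\<phi>\<close> is the Frechet derivative of the norm at the unit vector \<open>y\<close>. Only the
  upper estimate is demanded: the lower one follows from it, since
  \<open>2 * norm y \<le> norm (y + h) + norm (y - h)\<close>.
\<close>

definition smooth_support :: "('a::real_normed_vector \<Rightarrow>\<^sub>L real) \<Rightarrow> 'a \<Rightarrow> bool" where
  "smooth_support \<phi> y \<longleftrightarrow> norm y = 1 \<and>
     (\<forall>\<epsilon>>0. \<exists>\<eta>>0. \<forall>h. norm h \<le> \<eta> \<longrightarrow> norm (y + h) \<le> 1 + \<phi> h + \<epsilon> * norm h)"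

text \<open>
  Both estimates compare the first-order expansion with the exact value or the triangle
  inequality, along small multiples of a unit vector and of \<open>y\<close> itself.
\<close>

lemma smooth_support_bounds:
  assumes "smooth_support \<phi> y"
  shows "norm \<phi> \<le> 1" and "1 \<le> \<phi> y"
proof -
  have y: "norm y = 1"
    and ex: "\<And>\<epsilon>. \<epsilon> > 0 \<Longrightarrow> \<exists>\<eta>>0. \<forall>h. norm h \<le> \<eta> \<longrightarrow> norm (y + h) \<le> 1 + \<phi> h + \<epsilon> * norm h"
    using assms unfolding smooth_support_def by auto
  show "norm \<phi> \<le> 1"
  proof (rule field_le_epsilon)
    fix \<epsilon> :: real assume \<epsilon>: "0 < \<epsilon>"
    then obtain \<eta> where \<eta>: "0 < \<eta>" "\<And>h. norm h \<le> \<eta> \<Longrightarrow> norm (y + h) \<le> 1 + \<phi> h + \<epsilon> * norm h"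
      using ex by blast
    have *: "- \<phi> x \<le> 1 + \<epsilon>" if x: "norm x = 1" for x
    proof -
      have "1 - \<eta> \<le> norm (y + \<eta> *\<^sub>R x)"
        using norm_diff_ineq[of y "\<eta> *\<^sub>R x"] x y \<eta>(1) by simp
      also have "\<dots> \<le> 1 + \<phi> (\<eta> *\<^sub>R x) + \<epsilon> * norm (\<eta> *\<^sub>R x)"
        by (rule \<eta>(2)) (use x \<eta>(1) in simp)
      finally have "\<eta> * (- \<phi> x) \<le> \<eta> * (1 + \<epsilon>)"
        using x \<eta>(1) by (simp add: blinfun.scaleR_right algebra_simps)
      then show ?thesis by (rule mult_left_le_imp_le[OF _ \<eta>(1)])
    qed
    show "norm \<phi> \<le> 1 + \<epsilon>"
    proof (rule norm_blinfun_le_unit)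
      fix x :: 'a assume "norm x = 1"
      then show "norm (\<phi> x) \<le> 1 + \<epsilon>"
        using *[of x] *[of "- x"] by (simp add: blinfun.minus_right abs_le_iff)
    qed (use \<epsilon> in simp)
  qed
  show "1 \<le> \<phi> y"
  proof (rule field_le_epsilon)
    fix \<epsilon> :: real assume \<epsilon>: "0 < \<epsilon>"
    then obtain \<eta> where \<eta>: "0 < \<eta>" "\<And>h. norm h \<le> \<eta> \<Longrightarrow> norm (y + h) \<le> 1 + \<phi> h + \<epsilon> * norm h"
      using ex by blast
    have "norm (y + \<eta> *\<^sub>R y) = (1 + \<eta>) * norm y"
      using \<eta>(1) by (metis abs_of_pos add_pos_pos norm_scaleR scaleR_left_distrib scaleR_one zero_less_one)
    then have "1 + \<eta> \<le> 1 + \<phi> (\<eta> *\<^sub>R y) + \<epsilon> * norm (\<eta> *\<^sub>R y)"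
      using \<eta>(2)[of "\<eta> *\<^sub>R y"] y \<eta>(1) by simp
    then have "\<eta> * 1 \<le> \<eta> * (\<phi> y + \<epsilon>)"
      using y \<eta>(1) by (simp add: blinfun.scaleR_right algebra_simps)
    then show "1 \<le> \<phi> y + \<epsilon>" by (rule mult_left_le_imp_le[OF _ \<eta>(1)])
  qed
qed

text \<open>
  Minimise \<open>C * q (y - v) - norm y\<close>, with \<open>q\<close> the square of a Euclidean norm. At a minimum \<open>y0\<close>
  the norm is touched from above by a quadratic function, which forces it to be differentiable
  there. For large \<open>C\<close> the point \<open>y0\<close> is close to \<open>v\<close>; as the derivative has norm at most \<open>1\<close>
  and takes the value \<open>norm y0\<close> at \<open>y0\<close>, it cannot vanish at \<open>v\<close>.
\<close>

lemma exists_smooth_support: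
  fixes v :: "'a::real_normed_vector" and B :: "'a set"
  assumes B: "finite_basis B" and v: "v \<noteq> 0"
  shows "\<exists>\<phi> y. smooth_support \<phi> y \<and> \<phi> v \<noteq> 0"
proof -
  obtain ip :: "'a \<Rightarrow> 'a \<Rightarrow> real" and \<kappa> M where ip: "bounded_bilinear ip"
    and sym: "\<And>x y. ip x y = ip y x" and \<kappa>: "0 < \<kappa>" "\<And>x. \<kappa> * (norm x)\<^sup>2 \<le> ip x x"
    and M: "0 < M" "\<And>x. ip x x \<le> M * (norm x)\<^sup>2"
    using finite_basis_inner_form[OF B] by metis
  interpret ip: bounded_bilinear ip by (rule ip)
  \<comment> \<open>The minimum is sought within \<open>2 * \<rho>\<close> of \<open>v\<close>. The choice of \<open>C\<close> puts the minimiser within \<open>\<rho>\<close>,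
    so that perturbations by vectors of norm at most \<open>\<rho>\<close> stay in the region of minimisation.\<close>
  define \<rho> where "\<rho> = norm v / 8"
  have \<rho>: "0 < \<rho>" using v by (simp add: \<rho>_def)
  define C where "C = 1 / (\<kappa> * \<rho>)"
  have C: "0 < C" using \<rho> \<kappa>(1) by (simp add: C_def)
  define G where "G y = C * ip (y - v) (y - v) - norm y" for y
  have "\<exists>y0\<in>cball v (2 * \<rho>). \<forall>y\<in>cball v (2 * \<rho>). G y0 \<le> G y"
    unfolding G_def
    by (rule continuous_attains_inf)
      (use \<rho> in \<open>auto intro!: compact_cball_finite_basis[OF B] continuous_intros ip.continuous_on\<close>)
  then obtain y0 where min: "\<And>y. norm (y - v) \<le> 2 * \<rho> \<Longrightarrow> G y0 \<le> G y"
    by (metis dist_commute dist_norm mem_cball)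
  have near: "norm (y0 - v) \<le> \<rho>"
  proof (rule ccontr)
    assume "\<not> ?thesis"
    then have gt: "\<rho> < norm (y0 - v)" by simp
    have "C * (\<kappa> * (norm (y0 - v))\<^sup>2) \<le> C * ip (y0 - v) (y0 - v)"
      using C \<kappa>(2) by simp
    also have "\<dots> \<le> norm y0 - norm v"
      using min[of v] \<rho> by (simp add: G_def ip.zero_left)
    also have "\<dots> \<le> norm (y0 - v)" by (rule norm_triangle_ineq2)
    finally have "norm (y0 - v) * norm (y0 - v) \<le> \<rho> * norm (y0 - v)"
      using \<rho> \<kappa>(1) by (simp add: C_def field_simps power2_eq_square)
    with gt \<rho> show False by (simp add: mult_le_cancel_right)
  qed
  define \<nu> where "\<nu> = norm y0"
  have far: "norm (y0 - v) < \<nu>"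
    using near norm_triangle_ineq2[of v y0] \<rho>
    unfolding \<nu>_def \<rho>_def norm_minus_commute[of v y0] by linarith
  then have \<nu>: "0 < \<nu>" using norm_ge_zero[of "y0 - v"] by linarith
  define \<phi> where "\<phi> = Blinfun (\<lambda>h. 2 * C * ip (y0 - v) h)"
  have \<phi>: "\<phi> h = 2 * C * ip (y0 - v) h" for h
    unfolding \<phi>_def
    by (subst bounded_linear_Blinfun_apply)
      (auto intro!: bounded_linear_const_mult ip.bounded_linear_right)
  have upper: "norm (y0 + h) \<le> \<nu> + \<phi> h + C * M * (norm h)\<^sup>2" if "norm h \<le> \<rho>" for h
  proof -
    have "norm (y0 + h - v) \<le> 2 * \<rho>"
      using norm_triangle_ineq[of "y0 - v" h] near that by (simp add: algebra_simps)
    from min[OF this] have "norm (y0 + h) \<le> \<nu> + C * (ip (y0 - v + h) (y0 - v + h) - ip (y0 - v) (y0 - v))"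
      by (simp add: G_def \<nu>_def algebra_simps)
    also have "ip (y0 - v + h) (y0 - v + h) - ip (y0 - v) (y0 - v) = 2 * ip (y0 - v) h + ip h h"
      by (simp only: ip.add_left ip.add_right sym[of h "y0 - v"])
    also have "\<nu> + C * (2 * ip (y0 - v) h + ip h h) = \<nu> + \<phi> h + C * ip h h"
      by (simp add: \<phi> algebra_simps)
    also have "\<dots> \<le> \<nu> + \<phi> h + C * (M * (norm h)\<^sup>2)"
      using C M(2)[of h] by simp
    finally show ?thesis by (simp add: mult.assoc)
  qed
  define y where "y = (1 / \<nu>) *\<^sub>R y0"
  have y0: "y0 = \<nu> *\<^sub>R y" using \<nu> by (simp add: y_def)
  have smooth: "smooth_support \<phi> y"
    unfolding smooth_support_def
  proof (intro conjI allI impI)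
    show "norm y = 1" using \<nu> by (simp add: y_def \<nu>_def)
    fix \<epsilon> :: real assume \<epsilon>: "0 < \<epsilon>"
    define \<eta> where "\<eta> = min (\<rho> / \<nu>) (\<epsilon> / (C * M * \<nu>))"
    have \<eta>: "0 < \<eta>" using \<rho> \<nu> \<epsilon> C M(1) by (simp add: \<eta>_def)
    show "\<exists>\<eta>>0. \<forall>h. norm h \<le> \<eta> \<longrightarrow> norm (y + h) \<le> 1 + \<phi> h + \<epsilon> * norm h"
    proof (intro exI[of _ \<eta>] conjI allI impI \<eta>)
      fix h :: 'a assume h: "norm h \<le> \<eta>"
      then have h1: "\<nu> * norm h \<le> \<rho>" and h2: "C * M * \<nu> * norm h \<le> \<epsilon>"
        using \<nu> C M(1) by (simp_all add: \<eta>_def field_simps)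
      have "\<nu> * norm (y + h) = norm (y0 + \<nu> *\<^sub>R h)"
        using \<nu> by (metis y0 abs_of_pos norm_scaleR scaleR_add_right)
      also have "\<dots> \<le> \<nu> + \<phi> (\<nu> *\<^sub>R h) + C * M * (norm (\<nu> *\<^sub>R h))\<^sup>2"
        by (rule upper) (use \<nu> h1 in simp)
      also have "\<dots> = \<nu> * (1 + \<phi> h + (C * M * \<nu> * norm h) * norm h)"
        using \<nu> by (simp add: blinfun.scaleR_right power2_eq_square algebra_simps)
      also have "\<dots> \<le> \<nu> * (1 + \<phi> h + \<epsilon> * norm h)"
        using \<nu> h2 by (intro mult_left_mono add_left_mono mult_right_mono) auto
      finally show "norm (y + h) \<le> 1 + \<phi> h + \<epsilon> * norm h"
        using \<nu> by simp
    qed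
  qed
  have "\<nu> \<le> \<phi> y0"
    using smooth_support_bounds(2)[OF smooth] \<nu> by (simp add: y0 blinfun.scaleR_right)
  moreover have "\<phi> (y0 - v) \<le> norm (y0 - v)"
  proof -
    have "\<phi> (y0 - v) \<le> norm \<phi> * norm (y0 - v)" using norm_blinfun[of \<phi> "y0 - v"] by simp
    also have "\<dots> \<le> 1 * norm (y0 - v)"
      by (rule mult_right_mono[OF smooth_support_bounds(1)[OF smooth]]) simp
    finally show ?thesis by simp
  qed
  ultimately have "0 < \<phi> v" using far by (simp add: blinfun.diff_right)
  with smooth show ?thesis by force
qed

text \<open>
  A maximal independent set of derivatives of the norm still separates points, because a vector
  killed by it is killed by every derivative; its size is bounded by the dimension of the dual.
\<close>

lemma separating_smooth_supports:
  fixes B :: "'a::real_normed_vector set"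
  assumes B: "finite_basis B"
  shows "\<exists>\<Phi> :: ('a \<Rightarrow>\<^sub>L real) set. finite \<Phi> \<and> card \<Phi> \<le> card B \<and>
    (\<forall>\<phi>\<in>\<Phi>. \<exists>y. smooth_support \<phi> y) \<and> (\<forall>v. v \<noteq> 0 \<longrightarrow> (\<exists>\<phi>\<in>\<Phi>. \<phi> v \<noteq> 0))"
proof -
  let ?S = "{\<phi> :: 'a \<Rightarrow>\<^sub>L real. \<exists>y. smooth_support \<phi> y}"
  obtain \<Phi> where \<Phi>: "\<Phi> \<subseteq> ?S" "independent \<Phi>" "?S \<subseteq> span \<Phi>"
    using maximal_independent_subset by blast
  obtain D :: "('a \<Rightarrow>\<^sub>L real) set" where D: "finite_basis D" "card D \<le> card B"
    using dual_finite_basis[OF B] by metis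
  have "finite \<Phi> \<and> card \<Phi> \<le> card D"
    by (rule independent_span_bound) (use D \<Phi> in \<open>auto simp: finite_basis_def\<close>)
  moreover have "\<exists>\<phi>\<in>\<Phi>. \<phi> v \<noteq> 0" if v: "v \<noteq> 0" for v
  proof (rule ccontr)
    assume neg: "\<not> ?thesis"
    obtain \<phi> y where \<phi>: "smooth_support \<phi> y" "\<phi> v \<noteq> 0"
      using exists_smooth_support[OF B v] by blast
    have "\<psi> v = 0" if "\<psi> \<in> span \<Phi>" for \<psi>
      using that neg
      by (induction rule: span_induct_alt) (auto simp: blinfun.add_left blinfun.scaleR_left)
    moreover have "\<phi> \<in> span \<Phi>" using \<Phi>(3) \<phi>(1) by blast
    ultimately show False using \<phi>(2) by blast
  qed
  ultimately show ?thesis using \<Phi>(1) D(2) by (intro exI[of _ \<Phi>]) auto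
qed

section \<open>Families that detect operators\<close>

text \<open>
  The basis is fixed and the operator varies, so the constant must be uniform: an operator that is
  tiny on a basis is tiny on the unit ball, because coordinates are bounded.
\<close>

lemma finite_basis_detects_operators:
  fixes E :: "'a::real_normed_vector set"
  assumes E: "finite_basis E"
  shows "\<exists>c>0. \<forall>T :: 'a \<Rightarrow>\<^sub>L 'b::real_normed_vector. norm T = 1 \<longrightarrow> (\<exists>e\<in>E. c \<le> norm (blinfun_apply T e))"
proof -
  obtain M where M: "0 < M" "\<And>x e. \<bar>representation E x e\<bar> \<le> M * norm x"
    using representation_bound[OF E] by metis
  \<comment> \<open>One more than the cardinality, so that it is positive also for the empty basis.\<close>
  define N where "N = real (card E) + 1"
  have N: "0 < N" "card E \<le> N" by (simp_all add: N_def)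
  define c where "c = 1 / (2 * M * N)"
  have c: "0 < c" using M(1) N by (simp add: c_def)
  have "\<exists>e\<in>E. c \<le> norm (blinfun_apply T e)" if T: "norm T = 1" for T :: "'a \<Rightarrow>\<^sub>L 'b"
  proof (rule ccontr)
    assume "\<not> ?thesis"
    then have small: "norm (T e) \<le> c" if "e \<in> E" for e using that by force
    have "norm T \<le> 1 / 2"
    proof (rule norm_blinfun_bound)
      fix x
      have "T x = T (\<Sum>e\<in>E. representation E x e *\<^sub>R e)"
        by (simp add: sum_representation_finite_basis[OF E])
      also have "\<dots> = (\<Sum>e\<in>E. representation E x e *\<^sub>R T e)"
        by (simp add: blinfun.sum_right blinfun.scaleR_right)
      also have "norm \<dots> \<le> (\<Sum>e\<in>E. (M * norm x) * c)"
        using M small by (intro sum_norm_le) (auto intro!: mult_mono)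
      also have "\<dots> = card E * ((M * norm x) * c)" by simp
      also have "\<dots> \<le> N * ((M * norm x) * c)"
        using M(1) c N(2) by (intro mult_right_mono) auto
      also have "\<dots> = 1 / 2 * norm x"
        using M(1) N(1) by (simp add: c_def field_simps)
      finally show "norm (T x) \<le> 1 / 2 * norm x" .
    qed simp
    with T show False by simp
  qed
  with c show ?thesis by blast
qed

text \<open>
  The sum of the moduli of the functionals is bounded below on the compact unit sphere, hence
  dominates a multiple of the norm.
\<close>

lemma separating_functionals_detect_operators:
  fixes B :: "'b::real_normed_vector set" and \<Phi> :: "('b \<Rightarrow>\<^sub>L real) set"
  assumes B: "finite_basis B" and fin: "finite \<Phi>"
    and sep: "\<And>v. v \<noteq> 0 \<Longrightarrow> \<exists>\<phi>\<in>\<Phi>. \<phi> v \<noteq> 0"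
  shows "\<exists>c>0. \<forall>T :: 'a::real_normed_vector \<Rightarrow>\<^sub>L 'b. norm T = 1 \<longrightarrow> (\<exists>\<phi>\<in>\<Phi>. c \<le> norm (\<phi> o\<^sub>L T))"
proof (cases "sphere (0::'b) 1 = {}")
  case True
  \<comment> \<open>If the codomain is trivial, no operator has norm \<open>1\<close>.\<close>
  have "norm T \<noteq> 1" for T :: "'a \<Rightarrow>\<^sub>L 'b"
  proof -
    have "T x = 0" for x
    proof (rule ccontr)
      assume "T x \<noteq> 0"
      then have "(1 / norm (T x)) *\<^sub>R T x \<in> sphere 0 1" by simp
      with True show False by blast
    qed
    then have "T = 0" by (intro blinfun_eqI) simp
    then show ?thesis by simp
  qed
  then show ?thesis by (intro exI[of _ 1]) simp
next
  case False
  define F where "F y = (\<Sum>\<phi>\<in>\<Phi>. \<bar>blinfun_apply \<phi> y\<bar>)" for y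
  have "\<exists>x\<in>sphere 0 1. \<forall>y\<in>sphere 0 1. F x \<le> F y"
    unfolding F_def
    by (intro continuous_attains_inf compact_sphere_finite_basis[OF B] False continuous_intros)
  then obtain w where w: "norm w = 1" "\<And>y. norm y = 1 \<Longrightarrow> F w \<le> F y" by auto
  have Fw: "0 < F w"
  proof -
    have "w \<noteq> 0" using w(1) by auto
    then obtain \<phi> where "\<phi> \<in> \<Phi>" "\<phi> w \<noteq> 0" using sep by blast
    then show ?thesis unfolding F_def using fin by (intro sum_pos2[of _ \<phi>]) auto
  qed
  have low: "F w * norm y \<le> F y" for y
  proof (cases "y = 0")
    case False
    then have "F w \<le> F ((1 / norm y) *\<^sub>R y)" by (intro w(2)) simp
    also have "\<dots> = F y / norm y"
      by (simp add: F_def blinfun.scaleR_right abs_mult sum_divide_distrib)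
    finally show ?thesis using False by (simp add: field_simps)
  qed (simp add: F_def)
  define N where "N = real (card \<Phi>) + 1"
  have N: "0 < N" "card \<Phi> \<le> N" by (simp_all add: N_def)
  define c where "c = F w / (2 * N)"
  have c: "0 < c" using Fw N by (simp add: c_def)
  have "\<exists>\<phi>\<in>\<Phi>. c \<le> norm (\<phi> o\<^sub>L T)" if T: "norm T = 1" for T :: "'a \<Rightarrow>\<^sub>L 'b"
  proof (rule ccontr)
    assume "\<not> ?thesis"
    then have small: "norm (\<phi> o\<^sub>L T) \<le> c" if "\<phi> \<in> \<Phi>" for \<phi> using that by force
    have "norm T \<le> 1 / 2"
    proof (rule norm_blinfun_bound)
      fix x
      have "F w * norm (T x) \<le> F (T x)" by (rule low)
      also have "\<dots> \<le> (\<Sum>\<phi>\<in>\<Phi>. c * norm x)"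
        unfolding F_def
      proof (rule sum_mono)
        fix \<phi> assume "\<phi> \<in> \<Phi>"
        then show "\<bar>\<phi> (T x)\<bar> \<le> c * norm x"
          using norm_blinfun[of "\<phi> o\<^sub>L T" x] mult_right_mono[OF small norm_ge_zero[of x]]
          by force
      qed
      also have "\<dots> = card \<Phi> * (c * norm x)" by simp
      also have "\<dots> \<le> N * (c * norm x)"
        using c N(2) by (intro mult_right_mono) auto
      also have "\<dots> = F w * (1 / 2 * norm x)"
        using N(1) by (simp add: c_def field_simps)
      finally show "norm (T x) \<le> 1 / 2 * norm x"
        using Fw by (simp only: mult_le_cancel_left_pos)
    qed simp
    with T show False by simp
  qed
  with c show ?thesis by blast
qed

section \<open>Lifting ball coverings\<close>

text \<open>
  Coverings may be indexed by any finite set of at most \<open>k\<close> elements, since balls may be repeated;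
  repetition needs at least one ball, whence the condition on the empty index set.
\<close>

lemma admits_ball_coveringI:
  fixes z :: "'i \<Rightarrow> 'z::real_normed_vector" and r :: "'i \<Rightarrow> real"
  assumes "finite I" and "card I \<le> k" and "I = {} \<Longrightarrow> k = 0"
    and "\<And>i. i \<in> I \<Longrightarrow> z i \<noteq> 0 \<and> 0 < r i \<and> r i \<le> norm (z i)"
    and "A \<subseteq> (\<Union>i\<in>I. ball (z i) (r i))"
  shows "admits_ball_covering A k"
proof (cases "I = {}")
  case True
  then show ?thesis using assms unfolding admits_ball_covering_def by auto
next
  case False
  have pos: "0 < card I" using False assms(1) by (simp add: card_gt_0_iff)
  obtain f where f: "bij_betw f {0..<card I} I"
    using ex_bij_betw_nat_finite[OF assms(1)] by blast
  \<comment> \<open>Cyclic repetition; the index \<open>card I\<close> takes the role of \<open>0\<close>, which is not in \<open>{1..k}\<close>.\<close>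
  define h where "h j = f (j mod card I)" for j
  have hI: "h j \<in> I" for j
    using f pos unfolding h_def by (intro bij_betwE[OF f, rule_format]) auto
  have "\<exists>j\<in>{1..k}. h j = i" if "i \<in> I" for i
  proof -
    have "i \<in> f ` {0..<card I}" using f that by (simp add: bij_betw_def)
    then obtain l where l: "l < card I" "f l = i" by auto
    show ?thesis
    proof (cases "l = 0")
      case True
      then show ?thesis using l pos assms(2) by (intro bexI[of _ "card I"]) (auto simp: h_def)
    next
      case False
      then show ?thesis using l assms(2) by (intro bexI[of _ l]) (auto simp: h_def)
    qed
  qed
  then have "(\<Union>i\<in>I. ball (z i) (r i)) \<subseteq> (\<Union>j\<in>{1..k}. ball (z (h j)) (r (h j)))"
    by blast
  then show ?thesis
    unfolding admits_ball_covering_def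
    using assms(4,5) hI
    by (intro exI[of _ "z \<circ> h"] exI[of _ "r \<circ> h"]) auto
qed

text \<open>
  A Lebesgue-number argument: the total depth of a point inside the balls is continuous and
  positive on the compact set, and one ball contributes at least the average.
\<close>

lemma ball_covering_margin:
  fixes z :: "nat \<Rightarrow> 'z::real_normed_vector"
  assumes "compact S" and "S \<subseteq> (\<Union>i\<in>{1..p}. ball (z i) (r i))"
  shows "\<exists>\<delta>>0. \<forall>y\<in>S. \<exists>i\<in>{1..p}. norm (z i - y) \<le> r i - \<delta>"
proof (cases "S = {}")
  case True
  then show ?thesis by (intro exI[of _ 1]) simp
next
  case False
  define F where "F y = (\<Sum>i\<in>{1..p}. max 0 (r i - norm (z i - y)))" for y
  have pos: "0 < F y" if y: "y \<in> S" for y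
  proof -
    obtain i where "i \<in> {1..p}" "norm (z i - y) < r i"
      using assms(2) y by (auto simp: dist_norm)
    then show ?thesis
      unfolding F_def by (intro sum_pos2[of _ i]) auto
  qed
  have "\<exists>x\<in>S. \<forall>y\<in>S. F x \<le> F y"
    unfolding F_def by (intro continuous_attains_inf assms(1) False continuous_intros)
  then obtain x where x: "x \<in> S" "\<And>y. y \<in> S \<Longrightarrow> F x \<le> F y" by blast
  have p: "p \<noteq> 0" using pos[OF x(1)] by (intro notI) (simp add: F_def)
  define \<delta> where "\<delta> = F x / p"
  have \<delta>: "0 < \<delta>" using pos[OF x(1)] p by (simp add: \<delta>_def)
  have "\<exists>i\<in>{1..p}. norm (z i - y) \<le> r i - \<delta>" if y: "y \<in> S" for y
  proof (rule ccontr)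
    assume "\<not> ?thesis"
    then have "F y < (\<Sum>i\<in>{1..p}. \<delta>)"
      unfolding F_def using p \<delta> by (intro sum_strict_mono) (auto simp: not_le algebra_simps)
    then show False using x(2)[OF y] p by (simp add: \<delta>_def)
  qed
  with \<delta> show ?thesis by blast
qed

text \<open>
  This is the mechanism of the whole proof. The maps \<open>P k\<close> compress operators to the smaller space, and the maps \<open>J k\<close>
  embed that space isometrically. The last hypothesis says that, asymptotically in \<open>t\<close>, the
  distance from \<open>T\<close> to \<open>J k (t *\<^sub>R z)\<close> is controlled by the distance from \<open>P k T\<close> to \<open>t *\<^sub>R z\<close>.

  Balls whose radius is the norm of their centre grow when the centre is multiplied by \<open>t \<ge> 1\<close>,
  and the depth of a fixed point in them does not shrink. So a covering of the small sphere, with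
  all its centres multiplied by one large \<open>t\<close>, contains every compression \<open>P k T\<close> that is not
  too short, with a margin that absorbs the error term, and lifts to the operators.
\<close>

lemma ball_covering_lifting:
  fixes P :: "'k \<Rightarrow> 'w::real_normed_vector \<Rightarrow> 'z::real_normed_vector" and J :: "'k \<Rightarrow> 'z \<Rightarrow> 'w"
  assumes K: "finite K" "K \<noteq> {}" "card K \<le> d"
    and cpt: "compact (sphere (0::'z) 1)"
    and cov: "admits_ball_covering (sphere (0::'z) 1) p"
    and norm_J: "\<And>k z. k \<in> K \<Longrightarrow> norm (J k z) = norm z"
    and norm_P: "\<And>k T. k \<in> K \<Longrightarrow> norm T = 1 \<Longrightarrow> norm (P k T) \<le> 1"
    and c: "0 < c" "\<And>T. norm T = 1 \<Longrightarrow> \<exists>k\<in>K. c \<le> norm (P k T)"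
    and compare: "\<And>k z \<epsilon>. k \<in> K \<Longrightarrow> z \<noteq> 0 \<Longrightarrow> 0 < \<epsilon> \<Longrightarrow>
      \<forall>\<^sub>F t in at_top. \<forall>T. norm T = 1 \<longrightarrow>
        norm (J k (t *\<^sub>R z) - T) \<le> max (norm (t *\<^sub>R z - P k T) + \<epsilon>) (t * norm z - 1)"
  shows "admits_ball_covering (sphere (0::'w) 1) (d * p)"
proof -
  obtain z :: "nat \<Rightarrow> 'z" and r where
    zr: "\<And>i. i \<in> {1..p} \<Longrightarrow> z i \<noteq> 0 \<and> 0 < r i \<and> r i \<le> norm (z i)"
    and sub: "sphere 0 1 \<subseteq> (\<Union>i\<in>{1..p}. ball (z i) (r i))"
    using cov unfolding admits_ball_covering_def by metis
  obtain \<delta> where \<delta>: "0 < \<delta>"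
    and margin: "\<And>y. y \<in> sphere 0 1 \<Longrightarrow> \<exists>i\<in>{1..p}. norm (z i - y) \<le> r i - \<delta>"
    using ball_covering_margin[OF cpt sub] by blast
  \<comment> \<open>A compression of norm at least \<open>c\<close> has margin at least \<open>c * \<delta>\<close>; half of it pays for the error.\<close>
  define \<epsilon> where "\<epsilon> = c * \<delta> / 2"
  have \<epsilon>: "0 < \<epsilon>" "\<epsilon> < c * \<delta>" using c(1) \<delta> by (simp_all add: \<epsilon>_def)
  define Q where "Q t a \<longleftrightarrow> (\<forall>T. norm T = 1 \<longrightarrow> norm (J (fst a) (t *\<^sub>R z (snd a)) - T)
      \<le> max (norm (t *\<^sub>R z (snd a) - P (fst a) T) + \<epsilon>) (t * norm (z (snd a)) - 1))" for t a
  have "\<forall>\<^sub>F t in at_top. \<forall>a\<in>K \<times> {1..p}. Q t a"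
    by (rule eventually_ball_finite)
      (use K(1) zr \<epsilon>(1) in \<open>auto simp: Q_def intro!: compare\<close>)
  then have "\<forall>\<^sub>F t in at_top. 1 \<le> t \<and> (\<forall>a\<in>K \<times> {1..p}. Q t a)"
    by (intro eventually_conj eventually_ge_at_top)
  then obtain t :: real where t: "1 \<le> t" and Q: "\<And>a. a \<in> K \<times> {1..p} \<Longrightarrow> Q t a"
    using eventually_happens'[OF trivial_limit_at_top_linorder] by blast
  show ?thesis
  proof (rule admits_ball_coveringI)
    show "finite (K \<times> {1..p})" using K(1) by simp
    show "card (K \<times> {1..p}) \<le> d * p" using K(3) by (simp add: card_cartesian_product)
    show "d * p = 0" if "K \<times> {1..p} = {}" using that K(2) by auto
    show "J (fst a) (t *\<^sub>R z (snd a)) \<noteq> 0 \<and> 0 < t * norm (z (snd a)) \<and>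
        t * norm (z (snd a)) \<le> norm (J (fst a) (t *\<^sub>R z (snd a)))" if "a \<in> K \<times> {1..p}" for a
    proof -
      have "norm (J (fst a) (t *\<^sub>R z (snd a))) = t * norm (z (snd a))"
        using that t norm_J by auto
      moreover have "0 < t * norm (z (snd a))" using that t zr[of "snd a"] by auto
      ultimately show ?thesis by auto
    qed
    show "sphere 0 1 \<subseteq> (\<Union>a\<in>K \<times> {1..p}. ball (J (fst a) (t *\<^sub>R z (snd a))) (t * norm (z (snd a))))"
    proof
      fix T :: 'w assume "T \<in> sphere 0 1"
      then have T: "norm T = 1" by simp
      obtain k where k: "k \<in> K" "c \<le> norm (P k T)" using c(2)[OF T] by blast
      define \<tau> where "\<tau> = norm (P k T)"
      have \<tau>: "0 < \<tau>" "c \<le> \<tau>" "\<tau> \<le> t"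
        using c(1) k norm_P[OF k(1) T] t by (auto simp: \<tau>_def)
      define y where "y = (1 / \<tau>) *\<^sub>R P k T"
      have "y \<in> sphere 0 1" using \<tau>(1) by (simp add: y_def \<tau>_def)
      then obtain i where i: "i \<in> {1..p}" "norm (z i - y) \<le> r i - \<delta>" using margin by blast
      then have zy: "norm (z i - y) \<le> norm (z i) - \<delta>" using zr[OF i(1)] by linarith
      have "t *\<^sub>R z i - P k T = (t - \<tau>) *\<^sub>R z i + \<tau> *\<^sub>R (z i - y)"
        using \<tau>(1) by (simp add: y_def algebra_simps)
      then have "norm (t *\<^sub>R z i - P k T) \<le> norm ((t - \<tau>) *\<^sub>R z i) + norm (\<tau> *\<^sub>R (z i - y))"
        by (simp only: norm_triangle_ineq)
      also have "\<dots> \<le> (t - \<tau>) * norm (z i) + \<tau> * (norm (z i) - \<delta>)"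
        using \<tau> zy by simp
      also have "\<dots> \<le> t * norm (z i) - c * \<delta>"
        using \<tau>(2) \<delta> by (simp add: algebra_simps)
      finally have "norm (t *\<^sub>R z i - P k T) + \<epsilon> < t * norm (z i)" using \<epsilon>(2) by simp
      moreover have "norm (J k (t *\<^sub>R z i) - T)
          \<le> max (norm (t *\<^sub>R z i - P k T) + \<epsilon>) (t * norm (z i) - 1)"
        using Q[of "(k, i)"] k(1) i(1) T by (simp add: Q_def)
      ultimately have "norm (J k (t *\<^sub>R z i) - T) < t * norm (z i)" by linarith
      then show "T \<in> (\<Union>a\<in>K \<times> {1..p}. ball (J (fst a) (t *\<^sub>R z (snd a))) (t * norm (z (snd a))))"
        using k(1) i(1) by (intro UN_I[of "(k, i)"]) (auto simp: dist_norm)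
    qed
  qed
qed

section \<open>Distance to rank-one operators\<close>

definition rank_one :: "('a::real_normed_vector \<Rightarrow>\<^sub>L real) \<Rightarrow> 'b::real_normed_vector \<Rightarrow> 'a \<Rightarrow>\<^sub>L 'b" where
  "rank_one f y = blinfun_scaleR_left y o\<^sub>L f"

lemma rank_one_apply [simp]: "rank_one f y x = f x *\<^sub>R y"
  by (simp add: rank_one_def)

lemma norm_rank_one: "norm (rank_one f y) = norm f * norm y"
proof (rule antisym)
  show "norm (rank_one f y) \<le> norm f * norm y"
  proof (rule norm_blinfun_bound)
    show "norm (rank_one f y x) \<le> norm f * norm y * norm x" for x
      using mult_right_mono[OF norm_blinfun[of f x] norm_ge_zero[of y]] by (simp add: mult_ac)
  qed simp
  show "norm f * norm y \<le> norm (rank_one f y)"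
  proof (cases "y = 0")
    case False
    have "norm f \<le> norm (rank_one f y) / norm y"
    proof (rule norm_blinfun_bound)
      show "norm (f x) \<le> norm (rank_one f y) / norm y * norm x" for x
        using norm_blinfun[of "rank_one f y" x] False by (simp add: field_simps)
    qed simp
    with False show ?thesis by (simp add: field_simps)
  qed simp
qed

text \<open>
  Since the norm is even, half of the unit sphere suffices to estimate an operator norm.
\<close>

lemma norm_blinfun_le_halfspace:
  fixes f :: "'a::real_normed_vector \<Rightarrow>\<^sub>L 'b::real_normed_vector" and g :: "'a \<Rightarrow>\<^sub>L real"
  assumes "0 \<le> b" and "\<And>x. norm x = 1 \<Longrightarrow> 0 \<le> g x \<Longrightarrow> norm (f x) \<le> b"
  shows "norm f \<le> b"
proof (rule norm_blinfun_le_unit[OF assms(1)])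
  fix x :: 'a assume x: "norm x = 1"
  show "norm (f x) \<le> b"
    using assms(2)[of x] assms(2)[of "- x"] x by (cases "0 \<le> g x") (auto simp: blinfun.minus_right)
qed

text \<open>
  A unit vector \<open>x\<close> at which \<open>g\<close> is close to \<open>1\<close> is close to \<open>e\<close>, so there the values of the
  two operators differ by at most about the norm of \<open>t *\<^sub>R z - T e\<close>. At the other vectors the rank-one operator has norm below
  \<open>t * norm z\<close> by an amount proportional to \<open>t\<close>, which outweighs the bounded term \<open>T x\<close>.
\<close>

lemma norm_rank_one_diff_exposing:
  fixes z :: "'b::real_normed_vector" and g :: "'a::real_normed_vector \<Rightarrow>\<^sub>L real"
  assumes ge: "strongly_exposes g e" and z: "z \<noteq> 0" and \<epsilon>: "0 < \<epsilon>"
  shows "\<forall>\<^sub>F t in at_top. \<forall>T. norm T = 1 \<longrightarrow>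
    norm (rank_one g (t *\<^sub>R z) - T) \<le> max (norm (t *\<^sub>R z - T e) + \<epsilon>) (t * norm z - 1)"
proof -
  have ng: "norm g = 1" and ne: "norm e \<le> 1" using ge by (auto simp: strongly_exposes_def)
  obtain \<eta>0 where \<eta>0: "0 < \<eta>0"
    "\<And>x. norm x \<le> 1 \<Longrightarrow> 1 - \<eta>0 \<le> g x \<Longrightarrow> norm (x - e) \<le> \<epsilon> / 2"
    using ge \<epsilon> unfolding strongly_exposes_def by (metis half_gt_zero)
  define \<eta> where "\<eta> = min \<eta>0 (\<epsilon> / 2)"
  have \<eta>: "0 < \<eta>" "\<eta> \<le> \<eta>0" "\<eta> \<le> \<epsilon> / 2" using \<eta>0(1) \<epsilon> by (auto simp: \<eta>_def)
  have "\<forall>\<^sub>F t in at_top. max 0 (2 / (\<eta> * norm z)) \<le> t"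
    by (rule eventually_ge_at_top)
  then show ?thesis
  proof eventually_elim
    case (elim t)
    then have t: "0 \<le> t" "2 / (\<eta> * norm z) \<le> t"
      by (meson max.boundedE)+
    then have t2: "2 \<le> t * (\<eta> * norm z)"
      using \<eta>(1) z by (simp add: divide_le_eq)
    show ?case
    proof (intro allI impI norm_blinfun_le_halfspace[of _ g])
      fix T :: "'a \<Rightarrow>\<^sub>L 'b" assume T: "norm T = 1"
      show "0 \<le> max (norm (t *\<^sub>R z - T e) + \<epsilon>) (t * norm z - 1)"
        using \<epsilon> by (simp add: le_max_iff_disj)
      fix x :: 'a assume x: "norm x = 1" "0 \<le> g x"
      have Tle: "norm (T v) \<le> norm v" for v using norm_blinfun[of T v] T by simp
      have s1: "g x \<le> 1" using norm_blinfun[of g x] ng x by simp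
      define s where "s = g x"
      show "norm ((rank_one g (t *\<^sub>R z) - T) x) \<le> max (norm (t *\<^sub>R z - T e) + \<epsilon>) (t * norm z - 1)"
      proof (cases "1 - \<eta> \<le> s")
        case True
        then have xe: "norm (x - e) \<le> \<epsilon> / 2" using \<eta>0(2)[of x] x \<eta>(2) by (simp add: s_def)
        have "(rank_one g (t *\<^sub>R z) - T) x = s *\<^sub>R (t *\<^sub>R z - T e) - (1 - s) *\<^sub>R T e - T (x - e)"
          by (simp add: s_def blinfun.diff_left blinfun.diff_right algebra_simps)
        also have "norm \<dots> \<le> norm (s *\<^sub>R (t *\<^sub>R z - T e)) + norm ((1 - s) *\<^sub>R T e) + norm (T (x - e))"
          by (meson add_right_mono norm_triangle_ineq4 order_trans)
        also have "norm (s *\<^sub>R (t *\<^sub>R z - T e)) \<le> norm (t *\<^sub>R z - T e)"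
          using x s1 by (simp add: s_def mult_left_le_one_le)
        also have "norm ((1 - s) *\<^sub>R T e) \<le> \<epsilon> / 2"
        proof -
          have "norm ((1 - s) *\<^sub>R T e) \<le> (1 - s) * 1"
            unfolding norm_scaleR using s1 Tle[of e] ne by (intro mult_mono) (auto simp: s_def)
          with True \<eta>(3) show ?thesis by simp
        qed
        also have "norm (T (x - e)) \<le> \<epsilon> / 2" using Tle[of "x - e"] xe by simp
        finally show ?thesis by (simp add: le_max_iff_disj)
      next
        case False
        have "norm ((rank_one g (t *\<^sub>R z) - T) x) \<le> norm (s *\<^sub>R (t *\<^sub>R z)) + norm (T x)"
          using norm_triangle_ineq4[of "s *\<^sub>R (t *\<^sub>R z)" "T x"] by (simp add: s_def blinfun.diff_left)
        also have "\<dots> \<le> s * (t * norm z) + 1" using Tle[of x] x t by (simp add: s_def)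
        also have "s * (t * norm z) \<le> (1 - \<eta>) * (t * norm z)"
          using False t by (intro mult_right_mono) auto
        also have "(1 - \<eta>) * (t * norm z) + 1 \<le> t * norm z - 1"
          using t2 by (simp add: algebra_simps)
        finally show ?thesis by (simp add: le_max_iff_disj)
      qed
    qed
  qed
qed

text \<open>
  Where \<open>f x\<close> is not small, \<open>(t * f x) *\<^sub>R y\<close> is a long vector in the smooth direction \<open>y\<close>, and
  subtracting the bounded vector \<open>T x\<close> lowers its norm by \<open>\<phi> (T x)\<close> up to a small error. Where
  \<open>f x\<close> is small, the operator is far from attaining the norm \<open>t * norm f\<close>.
\<close>

lemma norm_rank_one_diff_smooth:
  fixes f :: "'a::real_normed_vector \<Rightarrow>\<^sub>L real" and y :: "'b::real_normed_vector"
  assumes sm: "smooth_support \<phi> y" and f: "f \<noteq> 0" and \<epsilon>: "0 < \<epsilon>"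
  shows "\<forall>\<^sub>F t in at_top. \<forall>T. norm T = 1 \<longrightarrow>
    norm (rank_one (t *\<^sub>R f) y - T) \<le> max (norm (t *\<^sub>R f - (\<phi> o\<^sub>L T)) + \<epsilon>) (t * norm f - 1)"
proof -
  have ny: "norm y = 1" using sm by (simp add: smooth_support_def)
  obtain \<eta> where \<eta>: "0 < \<eta>" "\<And>h. norm h \<le> \<eta> \<Longrightarrow> norm (y + h) \<le> 1 + \<phi> h + \<epsilon> * norm h"
    using sm \<epsilon> unfolding smooth_support_def by metis
  have "\<forall>\<^sub>F t in at_top. max (4 / norm f) (2 / (\<eta> * norm f)) \<le> t"
    by (rule eventually_ge_at_top)
  then show ?thesis
  proof eventually_elim
    case (elim t)
    then have t: "4 \<le> t * norm f" "2 \<le> t * norm f * \<eta>"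
      using \<eta>(1) f by (auto simp: divide_le_eq mult_ac)
    have tpos: "0 < t"
      using t(1) by (metis mult_nonpos_nonneg norm_ge_zero not_le not_numeral_le_zero order_trans)
    show ?case
    proof (intro allI impI norm_blinfun_le_halfspace[of _ f])
      fix T :: "'a \<Rightarrow>\<^sub>L 'b" assume T: "norm T = 1"
      show "0 \<le> max (norm (t *\<^sub>R f - (\<phi> o\<^sub>L T)) + \<epsilon>) (t * norm f - 1)"
        using \<epsilon> by (simp add: le_max_iff_disj)
      fix x :: 'a assume x: "norm x = 1" "0 \<le> f x"
      have Tx: "norm (T x) \<le> 1" using norm_blinfun[of T x] T x by simp
      define s where "s = t * f x"
      show "norm ((rank_one (t *\<^sub>R f) y - T) x)
          \<le> max (norm (t *\<^sub>R f - (\<phi> o\<^sub>L T)) + \<epsilon>) (t * norm f - 1)"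
      proof (cases "t * norm f \<le> 2 * s")
        case True
        have s: "0 < s" using True t(1) by linarith
        \<comment> \<open>Factoring out \<open>s\<close> turns the bounded vector \<open>T x\<close> into a small perturbation of \<open>y\<close>.\<close>
        define h where "h = (- 1 / s) *\<^sub>R T x"
        have "1 \<le> s * \<eta>" using mult_right_mono[OF True less_imp_le[OF \<eta>(1)]] t(2) by simp
        moreover have nh: "norm h = norm (T x) / s" using s by (simp add: h_def)
        ultimately have h: "norm h \<le> \<eta>" using Tx s by (simp add: divide_le_eq mult.commute)
        have sh: "s *\<^sub>R h = - T x" using s by (simp add: h_def)
        have "(rank_one (t *\<^sub>R f) y - T) x = s *\<^sub>R (y + h)"
          unfolding scaleR_add_right sh by (simp add: s_def blinfun.diff_left blinfun.scaleR_left)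
        then have "norm ((rank_one (t *\<^sub>R f) y - T) x) = s * norm (y + h)"
          using s by simp
        also have "\<dots> \<le> s * (1 + \<phi> h + \<epsilon> * norm h)"
          using s \<eta>(2)[OF h] by simp
        also have "\<dots> = (t *\<^sub>R f - (\<phi> o\<^sub>L T)) x + \<epsilon> * norm (T x)"
        proof -
          have "s * \<phi> h = \<phi> (s *\<^sub>R h)" by (simp add: blinfun.scaleR_right)
          then have "s * \<phi> h = - \<phi> (T x)" by (simp only: sh blinfun.minus_right)
          moreover have "s * norm h = norm (T x)" using s by (simp add: nh)
          ultimately have "s * (1 + \<phi> h + \<epsilon> * norm h) = s - \<phi> (T x) + \<epsilon> * norm (T x)"
            by (simp add: algebra_simps)
          then show ?thesis by (simp add: s_def blinfun.diff_left blinfun.scaleR_left)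
        qed
        also have "\<dots> \<le> norm (t *\<^sub>R f - (\<phi> o\<^sub>L T)) + \<epsilon>"
          using norm_blinfun[of "t *\<^sub>R f - (\<phi> o\<^sub>L T)" x] x Tx \<epsilon>
          by (intro add_mono) (auto simp: mult_left_le)
        finally show ?thesis by (simp add: le_max_iff_disj)
      next
        case False
        have "norm ((rank_one (t *\<^sub>R f) y - T) x) \<le> norm (s *\<^sub>R y) + norm (T x)"
          using norm_triangle_ineq4[of "s *\<^sub>R y" "T x"]
          by (simp add: s_def blinfun.diff_left blinfun.scaleR_left)
        also have "\<dots> \<le> s + 1" using Tx x tpos ny by (simp add: s_def)
        also have "\<dots> \<le> t * norm f - 1" using False t(1) by linarith
        finally show ?thesis by (simp add: le_max_iff_disj)
      qed
    qed
  qed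
qed

section \<open>Coverings of the sphere of operators\<close>

lemma finite_basis_vector_nonzero:
  assumes "finite_basis (B :: 'a::real_vector set)" and "B \<noteq> {}"
  shows "\<exists>v :: 'a. v \<noteq> 0"
proof -
  obtain b where "b \<in> B" using assms(2) by blast
  moreover have "0 \<notin> B" using assms(1) dependent_zero unfolding finite_basis_def by metis
  ultimately show ?thesis by metis
qed

text \<open>
  The covering of the sphere of \<open>'y\<close> is lifted along evaluation at the vectors of a basis of
  strongly exposed points.
\<close>

lemma operator_sphere_covering_exposed:
  fixes B :: "'x::real_normed_vector set" and D :: "'y::real_normed_vector set"
  assumes B: "finite_basis B" "B \<noteq> {}" and D: "finite_basis D"
    and cov: "admits_ball_covering (sphere (0 :: 'y) 1) q"
  shows "admits_ball_covering (sphere (0 :: 'x \<Rightarrow>\<^sub>L 'y) 1) (card B * q)"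
proof -
  obtain E :: "'x set" where E: "finite_basis E" "card E \<le> card B" "\<forall>e\<in>E. \<exists>g. strongly_exposes g e"
    using strongly_exposed_basis[OF B(1)] by blast
  obtain g where g: "\<And>e. e \<in> E \<Longrightarrow> strongly_exposes (g e) e" using E(3) by metis
  obtain c where c: "0 < c" "\<And>T :: 'x \<Rightarrow>\<^sub>L 'y. norm T = 1 \<Longrightarrow> \<exists>e\<in>E. c \<le> norm (blinfun_apply T e)"
    using finite_basis_detects_operators[OF E(1)] by metis
  have Ene: "E \<noteq> {}"
    using finite_basis_vector_nonzero[OF B] E(1) by (auto simp: finite_basis_def)
  show ?thesis
  proof (rule ball_covering_lifting[where K = E and P = "\<lambda>e T. blinfun_apply T e" and J = "\<lambda>e. rank_one (g e)"])
    show "norm (rank_one (g e) z) = norm z" if "e \<in> E" for e and z :: 'y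
      using g[OF that] by (simp add: norm_rank_one strongly_exposes_def)
    show "norm (T e) \<le> 1" if "e \<in> E" "norm T = 1" for e and T :: "'x \<Rightarrow>\<^sub>L 'y"
      using norm_blinfun[of T e] g[OF that(1)] that(2) by (simp add: strongly_exposes_def)
    show "finite E" using E(1) by (simp add: finite_basis_def)
  qed (use Ene E(2) compact_sphere_finite_basis[OF D] cov c in \<open>auto intro!: norm_rank_one_diff_exposing[OF g]\<close>)
qed

text \<open>
  The covering of the dual sphere is lifted along composition with the derivatives of the norm
  at finitely many smooth points of \<open>'y\<close>.
\<close>

lemma operator_sphere_covering_smooth:
  fixes B :: "'x::real_normed_vector set" and D :: "'y::real_normed_vector set"
  assumes B: "finite_basis B" and D: "finite_basis D" "D \<noteq> {}"
    and cov: "admits_ball_covering (sphere (0 :: 'x \<Rightarrow>\<^sub>L real) 1) p"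
  shows "admits_ball_covering (sphere (0 :: 'x \<Rightarrow>\<^sub>L 'y) 1) (card D * p)"
proof -
  obtain \<Phi> :: "('y \<Rightarrow>\<^sub>L real) set" where \<Phi>: "finite \<Phi>" "card \<Phi> \<le> card D"
    "\<forall>\<phi>\<in>\<Phi>. \<exists>y. smooth_support \<phi> y" "\<And>v. v \<noteq> 0 \<Longrightarrow> \<exists>\<phi>\<in>\<Phi>. \<phi> v \<noteq> 0"
    using separating_smooth_supports[OF D(1)] by metis
  obtain y where y: "\<And>\<phi>. \<phi> \<in> \<Phi> \<Longrightarrow> smooth_support \<phi> (y \<phi>)" using \<Phi>(3) by metis
  obtain c where c: "0 < c"
    "\<And>T :: 'x \<Rightarrow>\<^sub>L 'y. norm T = 1 \<Longrightarrow> \<exists>\<phi>\<in>\<Phi>. c \<le> norm (\<phi> o\<^sub>L T)"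
    using separating_functionals_detect_operators[OF D(1) \<Phi>(1,4)] by metis
  obtain X :: "('x \<Rightarrow>\<^sub>L real) set" where X: "finite_basis X"
    using dual_finite_basis[OF B] by metis
  have \<Phi>ne: "\<Phi> \<noteq> {}" using finite_basis_vector_nonzero[OF D] \<Phi>(4) by blast
  show ?thesis
  proof (rule ball_covering_lifting[where K = \<Phi> and P = "\<lambda>\<phi> T. \<phi> o\<^sub>L T" and J = "\<lambda>\<phi> f. rank_one f (y \<phi>)"])
    show "norm (rank_one f (y \<phi>)) = norm f" if "\<phi> \<in> \<Phi>" for \<phi> and f :: "'x \<Rightarrow>\<^sub>L real"
      using y[OF that] by (simp add: norm_rank_one smooth_support_def)
    show "norm (\<phi> o\<^sub>L T) \<le> 1" if "\<phi> \<in> \<Phi>" "norm T = 1" for \<phi> and T :: "'x \<Rightarrow>\<^sub>L 'y"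
      using norm_blinfun_compose[of \<phi> T] smooth_support_bounds(1)[OF y[OF that(1)]] that(2) by simp
  qed (use \<Phi>ne \<Phi>(1,2) compact_sphere_finite_basis[OF X] cov c in \<open>auto intro!: norm_rank_one_diff_smooth[OF y]\<close>)
qed

theorem proposition3p29:
  fixes m n p q :: nat
  assumes "1 \<le> m" and "1 \<le> n"
    and "has_dimension TYPE('x::banach) m"
    and "has_dimension TYPE('y::banach) n"
    and "admits_ball_covering (sphere (0 :: 'x \<Rightarrow>\<^sub>L real) 1) p"
    and "admits_ball_covering (sphere (0 :: 'y) 1) q"
  shows "admits_ball_covering (sphere (0 :: 'x \<Rightarrow>\<^sub>L 'y) 1) (min (m * q) (n * p))"
proof -
  obtain B :: "'x set" where B: "finite_basis B" "card B = m"
    using has_dimension_imp_finite_basis[OF assms(3)] by metis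
  obtain D :: "'y set" where D: "finite_basis D" "card D = n"
    using has_dimension_imp_finite_basis[OF assms(4)] by metis
  have ne: "B \<noteq> {}" "D \<noteq> {}" using assms(1,2) B(2) D(2) by auto
  have "admits_ball_covering (sphere (0 :: 'x \<Rightarrow>\<^sub>L 'y) 1) (m * q)"
    using operator_sphere_covering_exposed[OF B(1) ne(1) D(1) assms(6)] B(2) by simp
  moreover have "admits_ball_covering (sphere (0 :: 'x \<Rightarrow>\<^sub>L 'y) 1) (n * p)"
    using operator_sphere_covering_smooth[OF B(1) D(1) ne(2) assms(5)] D(2) by simp
  ultimately show ?thesis by (simp add: min_def)
qed

end
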